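(* The theory CC$'$ weakly interprets intuitionistic ${\rm Comp}({\rm PF}_{\mathcal T})+{\rm D}$; that is, for every theorem $\varphi$ of intuitionistic ${\rm Comp}({\rm PF}_{\mathcal T})+{\rm D}$ there is a theorem $\psi$ of CC$'$ such that deleting every occurrence of $\Box$ from $\psi$ yields $\varphi$ (where each term $\{x:\Box A(x)\}$ of CC$'$ becomes $\{x:A(x)\}$).
   Context: CC is the following system. Its language is the language of set theory ($\in$, $=$) augmented by a unary operator $\Box$, with formulas closed under $\wedge,\vee,\to,\forall,\exists$ and under $A\mapsto\Box A$; $\bot$ abbreviates $(\forall x)(\forall y)(x\in y)$ and $\neg A$ abbreviates $A\to\bot$. Its axioms and rules are those of intuitionistic predicate calculus with equality, plus: $A\to\Box A$; $\Box(A\wedge B)\leftrightarrow(\Box A\wedge\Box B)$; $\Box(A\vee B)\leftrightarrow(\Box A\vee\Box B)$; $\Box((\exists x)A)\leftrightarrow(\exists x)\Box A$; $\Box((\forall x)A)\leftrightarrow(\forall x)\Box A$; $\Box(A\to B)\to(\Box A\to\Box B)$; the rule "from $\Box A$ infer $A$"; extensionality $x=y\leftrightarrow(\forall u)(u\in x\leftrightarrow u\in y)$; and the comprehension scheme $(\exists x)(\forall r)(r\in x\leftrightarrow\Box A)$ for a fixed variable $r$, any variable $x$, and any formula $A$ in which $x$ is not free. CC$'$ is the extension of CC by definitions obtained by recursively adding, for every formula $A$ (of the extended language) and variable $x$, a term $\{x:\Box A(x)\}$ whose free variables are those of $A$ other than $x$, together with the axiom $y\in\{x:\Box A(x)\}\leftrightarrow\Box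 A(y)$ for every variable $y$. ${\rm Comp}({\rm PF}_{\mathcal T})+{\rm D}$ is the positive set theory whose language is that of set theory augmented by terms generated as follows: every variable is a term; if $s,t$ are terms then $s\in t$ and $s=t$ are positive formulas; if $A,B$ are positive formulas then so are $A\wedge B$, $A\vee B$, $(\forall x)A$, $(\exists x)A$; if $A$ is a positive formula and $x$ a variable then $\{x:A(x)\}$ is a term whose free variables are those of $A$ other than $x$. Its axioms are the comprehension scheme $y\in\{x:A(x)\}\leftrightarrow A(y)$ for positive formulas $A$ and variables $x,y$, and the axiom D: $(\exists x)(\exists y)(x\neq y)$. "Intuitionistic" means it is taken over intuitionistic predicate logic with equality (with $x\neq y$ meaning $x=y\to\bot$). *)

theory Defs
  imports Main
begin

text \<open>One syntax serves both theories.  Variables are de Bruijn indices; the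
binders are All, Ex and the comprehension term former Cmp (which binds index 0
in its body).  In CC' the term Cmp A denotes the term written {x : Box A(x)};
in Comp(PF_T)+D the term Cmp A denotes {x : A(x)}.\<close>

datatype tm = Var nat | Cmp fm
and fm = Mem tm tm | Eq tm tm | Conj fm fm | Disj fm fm | Imp fm fm
       | All fm | Ex fm | Box fm

primrec lift_tm :: "nat \<Rightarrow> tm \<Rightarrow> tm" and lift_fm :: "nat \<Rightarrow> fm \<Rightarrow> fm" where
  "lift_tm k (Var n) = Var (if n < k then n else Suc n)"
| "lift_tm k (Cmp A) = Cmp (lift_fm (Suc k) A)"
| "lift_fm k (Mem s t) = Mem (lift_tm k s) (lift_tm k t)"
| "lift_fm k (Eq s t) = Eq (lift_tm k s) (lift_tm k t)"
| "lift_fm k (Conj A B) = Conj (lift_fm k A) (lift_fm k B)"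
| "lift_fm k (Disj A B) = Disj (lift_fm k A) (lift_fm k B)"
| "lift_fm k (Imp A B) = Imp (lift_fm k A) (lift_fm k B)"
| "lift_fm k (All A) = All (lift_fm (Suc k) A)"
| "lift_fm k (Ex A) = Ex (lift_fm (Suc k) A)"
| "lift_fm k (Box A) = Box (lift_fm k A)"

primrec subst_tm :: "nat \<Rightarrow> tm \<Rightarrow> tm \<Rightarrow> tm" and subst_fm :: "nat \<Rightarrow> tm \<Rightarrow> fm \<Rightarrow> fm" where
  "subst_tm k s (Var n) = (if n < k then Var n else if n = k then s else Var (n - 1))"
| "subst_tm k s (Cmp A) = Cmp (subst_fm (Suc k) (lift_tm 0 s) A)"
| "subst_fm k s (Mem t u) = Mem (subst_tm k s t) (subst_tm k s u)"
| "subst_fm k s (Eq t u) = Eq (subst_tm k s t) (subst_tm k s u)"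
| "subst_fm k s (Conj A B) = Conj (subst_fm k s A) (subst_fm k s B)"
| "subst_fm k s (Disj A B) = Disj (subst_fm k s A) (subst_fm k s B)"
| "subst_fm k s (Imp A B) = Imp (subst_fm k s A) (subst_fm k s B)"
| "subst_fm k s (All A) = All (subst_fm (Suc k) (lift_tm 0 s) A)"
| "subst_fm k s (Ex A) = Ex (subst_fm (Suc k) (lift_tm 0 s) A)"
| "subst_fm k s (Box A) = Box (subst_fm k s A)"

definition inst :: "fm \<Rightarrow> tm \<Rightarrow> fm" where
  "inst A t = subst_fm 0 t A"

definition Iff :: "fm \<Rightarrow> fm \<Rightarrow> fm" where
  "Iff A B = Conj (Imp A B) (Imp B A)"

definition Bot :: fm where
  "Bot = All (All (Mem (Var 1) (Var 0)))"

definition Neg :: "fm \<Rightarrow> fm" where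
  "Neg A = Imp A Bot"

inductive logax :: "fm \<Rightarrow> bool" where
  ax_K: "logax (Imp A (Imp B A))"
| ax_S: "logax (Imp (Imp A (Imp B C)) (Imp (Imp A B) (Imp A C)))"
| ax_conjE1: "logax (Imp (Conj A B) A)"
| ax_conjE2: "logax (Imp (Conj A B) B)"
| ax_conjI: "logax (Imp A (Imp B (Conj A B)))"
| ax_disjI1: "logax (Imp A (Disj A B))"
| ax_disjI2: "logax (Imp B (Disj A B))"
| ax_disjE: "logax (Imp (Imp A C) (Imp (Imp B C) (Imp (Disj A B) C)))"
| ax_efq: "logax (Imp Bot A)"
| ax_allE: "logax (Imp (All A) (inst A t))"
| ax_exI: "logax (Imp (inst A t) (Ex A))"
| ax_allI: "logax (Imp (All (Imp (lift_fm 0 B) A)) (Imp B (All A)))"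
| ax_exE: "logax (Imp (All (Imp A (lift_fm 0 B))) (Imp (Ex A) B))"
| ax_refl: "logax (Eq t t)"
| ax_subst: "logax (Imp (Eq s t) (Imp (inst A s) (inst A t)))"

inductive cc_ax :: "fm \<Rightarrow> bool" where
  cc_box_intro: "cc_ax (Imp A (Box A))"
| cc_box_conj: "cc_ax (Iff (Box (Conj A B)) (Conj (Box A) (Box B)))"
| cc_box_disj: "cc_ax (Iff (Box (Disj A B)) (Disj (Box A) (Box B)))"
| cc_box_ex: "cc_ax (Iff (Box (Ex A)) (Ex (Box A)))"
| cc_box_all: "cc_ax (Iff (Box (All A)) (All (Box A)))"
| cc_box_imp: "cc_ax (Imp (Box (Imp A B)) (Imp (Box A) (Box B)))"
| cc_ext: "cc_ax (Iff (Eq (Var i) (Var j))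
                      (All (Iff (Mem (Var 0) (Var (Suc i))) (Mem (Var 0) (Var (Suc j))))))"
  \<comment> \<open>comprehension: (exists x)(forall r)(r in x <-> Box A), x not free in A
      (index 0 = r, index 1 = x, made not free by lifting at level 1)\<close>
| cc_comp: "cc_ax (Ex (All (Iff (Mem (Var 0) (Var 1)) (Box (lift_fm 1 A)))))"
| cc_term: "cc_ax (Iff (Mem (Var n) (Cmp A)) (Box (inst A (Var n))))"

inductive cc_prov :: "fm \<Rightarrow> bool" where
  cc_logax: "logax A \<Longrightarrow> cc_prov A"
| cc_nonlog: "cc_ax A \<Longrightarrow> cc_prov A"
| cc_mp: "cc_prov (Imp A B) \<Longrightarrow> cc_prov A \<Longrightarrow> cc_prov B"
| cc_gen: "cc_prov A \<Longrightarrow> cc_prov (All A)"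
| cc_unbox: "cc_prov (Box A) \<Longrightarrow> cc_prov A"

primrec pf_tm :: "tm \<Rightarrow> bool" and positive :: "fm \<Rightarrow> bool" where
  "pf_tm (Var n) = True"
| "pf_tm (Cmp A) = positive A"
| "positive (Mem s t) = (pf_tm s \<and> pf_tm t)"
| "positive (Eq s t) = (pf_tm s \<and> pf_tm t)"
| "positive (Conj A B) = (positive A \<and> positive B)"
| "positive (Disj A B) = (positive A \<and> positive B)"
| "positive (Imp A B) = False"
| "positive (All A) = positive A"
| "positive (Ex A) = positive A"
| "positive (Box A) = False"

primrec pf_fm :: "fm \<Rightarrow> bool" where
  "pf_fm (Mem s t) = (pf_tm s \<and> pf_tm t)"
| "pf_fm (Eq s t) = (pf_tm s \<and> pf_tm t)"
| "pf_fm (Conj A B) = (pf_fm A \<and> pf_fm B)"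
| "pf_fm (Disj A B) = (pf_fm A \<and> pf_fm B)"
| "pf_fm (Imp A B) = (pf_fm A \<and> pf_fm B)"
| "pf_fm (All A) = pf_fm A"
| "pf_fm (Ex A) = pf_fm A"
| "pf_fm (Box A) = False"

inductive pf_ax :: "fm \<Rightarrow> bool" where
  pf_comp: "positive A \<Longrightarrow> pf_ax (Iff (Mem (Var n) (Cmp A)) (inst A (Var n)))"
| pf_D: "pf_ax (Ex (Ex (Neg (Eq (Var 1) (Var 0)))))"

inductive pf_prov :: "fm \<Rightarrow> bool" where
  pf_axiom: "logax A \<or> pf_ax A \<Longrightarrow> pf_fm A \<Longrightarrow> pf_prov A"
| pf_mp: "pf_prov (Imp A B) \<Longrightarrow> pf_prov A \<Longrightarrow> pf_prov B"
| pf_gen: "pf_prov A \<Longrightarrow> pf_prov (All A)"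

primrec erase_tm :: "tm \<Rightarrow> tm" and erase :: "fm \<Rightarrow> fm" where
  "erase_tm (Var n) = Var n"
| "erase_tm (Cmp A) = Cmp (erase A)"
| "erase (Mem s t) = Mem (erase_tm s) (erase_tm t)"
| "erase (Eq s t) = Eq (erase_tm s) (erase_tm t)"
| "erase (Conj A B) = Conj (erase A) (erase B)"
| "erase (Disj A B) = Disj (erase A) (erase B)"
| "erase (Imp A B) = Imp (erase A) (erase B)"
| "erase (All A) = All (erase A)"
| "erase (Ex A) = Ex (erase A)"
| "erase (Box A) = erase A"

end

theory Submission
  imports Defs
begin

text \<open>
  In CC' the term {x : A} satisfies t in {x : A} <-> Box A(t), so unfolding a comprehension term
  costs one box, and boxes cannot be removed under hypotheses: CC' proves Loeb's schema
  (Box A --> A) --> A.  So the placement of boxes has to depend on the proof: negative atoms get no boxes and positive atoms n boxes, for n large.  Say that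
  \<open>\<Gamma>\<close> entails C if CC' proves C^+ from \<open>\<Gamma>\<close>^- for some n.  This relation is closed under the
  cut-free rules of intuitionistic logic and, since Box^n (C^+) implies C^+ with larger n, under
  cuts on implication-free formulas; both directions of comprehension then hold as well.
  All other cuts are eliminated semantically: formulas are interpreted by sets of contexts that
  are closed with respect to entailment, modus ponens is sound for this interpretation, and
  validity yields entailment from the empty context.
\<close>

section \<open>Substitution\<close>

lemma lift_lift:
  "i \<le> k \<Longrightarrow> lift_tm (Suc k) (lift_tm i t) = lift_tm i (lift_tm k t)"
  "i \<le> k \<Longrightarrow> lift_fm (Suc k) (lift_fm i A) = lift_fm i (lift_fm k A)"
  by (induction t and A arbitrary: i k and i k) auto

lemma lift_subst_le:
  "j \<le> k \<Longrightarrow> lift_tm k (subst_tm j s t) = subst_tm j (lift_tm k s) (lift_tm (Suc k) t)"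
  "j \<le> k \<Longrightarrow> lift_fm k (subst_fm j s A) = subst_fm j (lift_tm k s) (lift_fm (Suc k) A)"
  by (induction t and A arbitrary: j k s and j k s) (auto simp: lift_lift)

lemma lift_subst_ge:
  "k \<le> j \<Longrightarrow> lift_tm k (subst_tm j s t) = subst_tm (Suc j) (lift_tm k s) (lift_tm k t)"
  "k \<le> j \<Longrightarrow> lift_fm k (subst_fm j s A) = subst_fm (Suc j) (lift_tm k s) (lift_fm k A)"
  by (induction t and A arbitrary: j k s and j k s) (auto simp: lift_lift)

lemma subst_lift [simp]:
  "subst_tm k s (lift_tm k t) = t"
  "subst_fm k s (lift_fm k A) = A"
  by (induction t and A arbitrary: k s and k s) auto

lemma subst_subst:
  "i \<le> j \<Longrightarrow> subst_tm j u (subst_tm i v t)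
     = subst_tm i (subst_tm j u v) (subst_tm (Suc j) (lift_tm i u) t)"
  "i \<le> j \<Longrightarrow> subst_fm j u (subst_fm i v A)
     = subst_fm i (subst_tm j u v) (subst_fm (Suc j) (lift_tm i u) A)"
  by (induction t and A arbitrary: i j u v and i j u v) (auto simp: lift_lift lift_subst_ge)

lemma subst_Var_lift [simp]:
  "subst_tm (Suc k) (Var k) (lift_tm k t) = t"
  "subst_fm (Suc k) (Var k) (lift_fm k A) = A"
  by (induction t and A arbitrary: k and k) auto

lemma subst_Var_lift_Suc:
  "subst_tm k (Var k) (lift_tm (Suc k) t) = t"
  "subst_fm k (Var k) (lift_fm (Suc k) A) = A"
  by (induction t and A arbitrary: k and k) auto

lemma subst_inst: "subst_fm k s (inst A t) = inst (subst_fm (Suc k) (lift_tm 0 s) A) (subst_tm k s t)"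
  by (simp add: inst_def subst_subst)

lemma lift_inst: "lift_fm k (inst A t) = inst (lift_fm (Suc k) A) (lift_tm k t)"
  by (simp add: inst_def lift_subst_le)

lemma inst_simps [simp]:
  "inst (Mem u v) t = Mem (subst_tm 0 t u) (subst_tm 0 t v)"
  "inst (Eq u v) t = Eq (subst_tm 0 t u) (subst_tm 0 t v)"
  "inst (Conj A B) t = Conj (inst A t) (inst B t)"
  "inst (Disj A B) t = Disj (inst A t) (inst B t)"
  "inst (Imp A B) t = Imp (inst A t) (inst B t)"
  "inst (Box A) t = Box (inst A t)"
  "inst (lift_fm 0 A) t = A"
  "inst (lift_fm (Suc 0) A) (Var 0) = A"
  by (simp_all add: inst_def subst_Var_lift_Suc)

text \<open>\<open>lift_fm k A = A\<close> means that no index \<ge> k is free in A. Formulas are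
  finite, so every large enough index is fresh; eigenvariables are chosen this way.\<close>

lemma eventually_lift_ident:
  "\<exists>m. \<forall>k\<ge>m. lift_tm k t = t"
  "\<exists>m. \<forall>k\<ge>m. lift_fm k A = A"
proof (induction t and A)
  case (Var n) show ?case by (rule exI[of _ "Suc n"]) auto
next
  case (Cmp A) then show ?case by (auto intro: le_SucI)
next
  case (All A) then show ?case by (auto intro: le_SucI)
next
  case (Ex A) then show ?case by (auto intro: le_SucI)
next
  case (Box A) then show ?case by auto
next
  case (Mem s t) then obtain m n where "\<forall>k\<ge>m. lift_tm k s = s" "\<forall>k\<ge>n. lift_tm k t = t" by auto
  then show ?case by (intro exI[of _ "max m n"]) auto
next
  case (Eq s t) then obtain m n where "\<forall>k\<ge>m. lift_tm k s = s" "\<forall>k\<ge>n. lift_tm k t = t" by auto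
  then show ?case by (intro exI[of _ "max m n"]) auto
next
  case (Conj s t) then obtain m n where "\<forall>k\<ge>m. lift_fm k s = s" "\<forall>k\<ge>n. lift_fm k t = t" by auto
  then show ?case by (intro exI[of _ "max m n"]) auto
next
  case (Disj s t) then obtain m n where "\<forall>k\<ge>m. lift_fm k s = s" "\<forall>k\<ge>n. lift_fm k t = t" by auto
  then show ?case by (intro exI[of _ "max m n"]) auto
next
  case (Imp s t) then obtain m n where "\<forall>k\<ge>m. lift_fm k s = s" "\<forall>k\<ge>n. lift_fm k t = t" by auto
  then show ?case by (intro exI[of _ "max m n"]) auto
qed

lemma eventually_lift_ident_list: "\<exists>m. \<forall>A\<in>set \<Gamma>. \<forall>k\<ge>m. lift_fm k A = A"
proof (induction \<Gamma>)
  case (Cons A \<Gamma>)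
  obtain m n where "\<forall>k\<ge>m. lift_fm k A = A" "\<forall>A\<in>set \<Gamma>. \<forall>k\<ge>n. lift_fm k A = A"
    using Cons eventually_lift_ident(2) by blast
  then show ?case by (intro exI[of _ "max m n"]) auto
qed simp

lemma subst_Bot [simp]: "subst_fm k s Bot = Bot"
  and lift_Bot [simp]: "lift_fm k Bot = Bot"
  by (simp_all add: Bot_def)

section \<open>Closure of axioms and theorems under substitution and shifting\<close>

lemma logax_subst: "logax A \<Longrightarrow> logax (subst_fm k s A)"
  by (induction rule: logax.induct) (auto simp: subst_inst lift_subst_ge[symmetric] intro: logax.intros)

lemma logax_lift: "logax A \<Longrightarrow> logax (lift_fm k A)"
  by (induction rule: logax.induct) (auto simp: lift_inst lift_lift intro: logax.intros)

text \<open>Restricted to variables because \<open>cc_ext\<close> and \<open>cc_term\<close> are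
  stated for variables only; a compound term would lead out of the axioms. Compound terms enter
  later, by generalising and specialising.\<close>

lemma cc_ax_subst_Var: "cc_ax A \<Longrightarrow> cc_ax (subst_fm k (Var j) A)"
proof (induction rule: cc_ax.induct)
  case (cc_comp A)
  \<comment> \<open>The side condition on x is encoded as a shift at level 1, which must commute
    with the substitution taken under two binders.\<close>
  have "subst_fm (Suc (Suc k)) (Var (Suc (Suc j))) (lift_fm 1 A)
      = lift_fm 1 (subst_fm (Suc k) (Var (Suc j)) A)"
    by (simp add: lift_subst_ge)
  then show ?case using cc_ax.cc_comp by (simp add: Iff_def)
next
  case (cc_term n A)
  show ?case
    using cc_ax.cc_term[where A = "subst_fm (Suc k) (Var (Suc j)) A"]
    by (auto simp: Iff_def subst_inst)
next
  case (cc_ext i i')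
  let ?f = "\<lambda>n. if n < k then n else if n = k then j else n - 1"
  show ?case using cc_ax.cc_ext[of "?f i" "?f i'"] by (auto simp: Iff_def split: if_splits)
qed (auto simp: Iff_def intro: cc_ax.intros[unfolded Iff_def])

lemma cc_ax_lift: "cc_ax A \<Longrightarrow> cc_ax (lift_fm k A)"
proof (induction rule: cc_ax.induct)
  case (cc_comp A)
  have "lift_fm (Suc (Suc k)) (lift_fm 1 A) = lift_fm 1 (lift_fm (Suc k) A)"
    by (simp add: lift_lift)
  then show ?case using cc_ax.cc_comp by (simp add: Iff_def)
next
  case (cc_term n A)
  show ?case
    using cc_ax.cc_term[where A = "lift_fm (Suc k) A"]
    by (auto simp: Iff_def lift_inst)
next
  case (cc_ext i i')
  let ?f = "\<lambda>n. if n < k then n else Suc n"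
  show ?case using cc_ax.cc_ext[of "?f i" "?f i'"] by (auto simp: Iff_def split: if_splits)
qed (auto simp: Iff_def intro: cc_ax.intros[unfolded Iff_def])

lemma cc_prov_subst_Var: "cc_prov A \<Longrightarrow> cc_prov (subst_fm k (Var j) A)"
proof (induction arbitrary: k j rule: cc_prov.induct)
  case (cc_mp A B) then show ?case by (metis cc_prov.cc_mp subst_fm.simps(5))
qed (auto intro: cc_prov.intros logax_subst cc_ax_subst_Var)

lemma cc_prov_lift: "cc_prov A \<Longrightarrow> cc_prov (lift_fm k A)"
proof (induction arbitrary: k rule: cc_prov.induct)
  case (cc_mp A B) then show ?case by (metis cc_prov.cc_mp lift_fm.simps(5))
qed (auto intro: cc_prov.intros logax_lift cc_ax_lift)

lemma fm_induct [case_names Mem Eq Conj Disj Imp All Ex Box]: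
  assumes "\<And>s t. P (Mem s t)" "\<And>s t. P (Eq s t)"
    "\<And>A B. P A \<Longrightarrow> P B \<Longrightarrow> P (Conj A B)" "\<And>A B. P A \<Longrightarrow> P B \<Longrightarrow> P (Disj A B)"
    "\<And>A B. P A \<Longrightarrow> P B \<Longrightarrow> P (Imp A B)" "\<And>A. P A \<Longrightarrow> P (All A)" "\<And>A. P A \<Longrightarrow> P (Ex A)"
    "\<And>A. P A \<Longrightarrow> P (Box A)"
  shows "P A"
  by (rule fm.induct[of "\<lambda>_. True"]) (use assms in auto)

section \<open>Derivability from hypotheses in CC'\<close>

text \<open>Contexts are nested implications, so the deduction theorem holds by definition, and
  \<open>cc_gen\<close> and \<open>cc_unbox\<close> act only on the whole nested
  implication.\<close>

primrec drv :: "fm list \<Rightarrow> fm \<Rightarrow> bool" where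
  "drv [] C = cc_prov C"
| "drv (A # \<Gamma>) C = drv \<Gamma> (Imp A C)"

lemma drv_mp: "drv \<Gamma> (Imp A B) \<Longrightarrow> drv \<Gamma> A \<Longrightarrow> drv \<Gamma> B"
  and drv_prov: "cc_prov C \<Longrightarrow> drv \<Gamma> C"
proof -
  \<comment> \<open>Both claims go into one induction: for a longer context, modus ponens uses axiom
    S as a theorem in the shorter one.\<close>
  have "(\<forall>A B. drv \<Gamma> (Imp A B) \<longrightarrow> drv \<Gamma> A \<longrightarrow> drv \<Gamma> B) \<and> (\<forall>C. cc_prov C \<longrightarrow> drv \<Gamma> C)"
  proof (induction \<Gamma>)
    case Nil then show ?case by (auto intro: cc_mp)
  next
    case (Cons X \<Gamma>)
    then have "cc_prov C \<longrightarrow> drv \<Gamma> (Imp X C)" for C by (meson ax_K cc_logax)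
    moreover have "drv \<Gamma> (Imp X (Imp A B)) \<longrightarrow> drv \<Gamma> (Imp X A) \<longrightarrow> drv \<Gamma> (Imp X B)" for A B
      using Cons by (meson ax_S cc_logax)
    ultimately show ?case by simp
  qed
  then show "drv \<Gamma> (Imp A B) \<Longrightarrow> drv \<Gamma> A \<Longrightarrow> drv \<Gamma> B" "cc_prov C \<Longrightarrow> drv \<Gamma> C" by blast+
qed

lemma drv_logax: "logax C \<Longrightarrow> drv \<Gamma> C"
  by (simp add: drv_prov cc_logax)

lemma drv_refl: "drv (A # \<Gamma>) A"
  by simp (meson ax_K ax_S drv_logax drv_mp)

lemma drv_weaken: "drv \<Gamma> C \<Longrightarrow> drv (A # \<Gamma>) C"
  by simp (meson ax_K drv_logax drv_mp)

lemma drv_hyp: "A \<in> set \<Gamma> \<Longrightarrow> drv \<Gamma> A"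
proof (induction \<Gamma>)
  case (Cons X \<Gamma>)
  then show ?case using drv_refl drv_weaken by (metis set_ConsD)
qed simp

lemma drv_trans: "drv \<Gamma> C \<Longrightarrow> (\<And>G. G \<in> set \<Gamma> \<Longrightarrow> drv \<Delta> G) \<Longrightarrow> drv \<Delta> C"
proof (induction \<Gamma> arbitrary: C)
  case Nil then show ?case by (simp add: drv_prov)
next
  case (Cons X \<Gamma>)
  then show ?case by (metis drv.simps(2) drv_mp list.set_intros)
qed

lemma drv_mono: "drv \<Gamma> C \<Longrightarrow> set \<Gamma> \<subseteq> set \<Delta> \<Longrightarrow> drv \<Delta> C"
  by (erule drv_trans) (auto intro: drv_hyp)

lemma drv_conjI: "drv \<Gamma> A \<Longrightarrow> drv \<Gamma> B \<Longrightarrow> drv \<Gamma> (Conj A B)"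
  by (meson ax_conjI drv_logax drv_mp)

lemma drv_conjD1: "drv \<Gamma> (Conj A B) \<Longrightarrow> drv \<Gamma> A"
  by (meson ax_conjE1 drv_logax drv_mp)

lemma drv_conjD2: "drv \<Gamma> (Conj A B) \<Longrightarrow> drv \<Gamma> B"
  by (meson ax_conjE2 drv_logax drv_mp)

lemma drv_disjI1: "drv \<Gamma> A \<Longrightarrow> drv \<Gamma> (Disj A B)"
  by (meson ax_disjI1 drv_logax drv_mp)

lemma drv_disjI2: "drv \<Gamma> B \<Longrightarrow> drv \<Gamma> (Disj A B)"
  by (meson ax_disjI2 drv_logax drv_mp)

lemma drv_disjE: "drv \<Gamma> (Disj A B) \<Longrightarrow> drv (A # \<Gamma>) C \<Longrightarrow> drv (B # \<Gamma>) C \<Longrightarrow> drv \<Gamma> C"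
  by simp (meson ax_disjE drv_logax drv_mp)

lemma drv_Disj_mono:
  assumes "drv [A] A'" and "drv [B] B'" and "drv \<Gamma> (Disj A B)"
  shows "drv \<Gamma> (Disj A' B')"
proof (rule drv_disjE[OF assms(3)])
  show "drv (A # \<Gamma>) (Disj A' B')" by (rule drv_disjI1, rule drv_mono[OF assms(1)]) simp
  show "drv (B # \<Gamma>) (Disj A' B')" by (rule drv_disjI2, rule drv_mono[OF assms(2)]) simp
qed

lemma drv_spec: "drv \<Gamma> (All A) \<Longrightarrow> drv \<Gamma> (inst A t)"
  by (meson ax_allE drv_logax drv_mp)

lemma drv_exI: "drv \<Gamma> (inst A t) \<Longrightarrow> drv \<Gamma> (Ex A)"
  by (meson ax_exI drv_logax drv_mp)

lemma drv_allI: "drv (map (lift_fm 0) \<Gamma>) A \<Longrightarrow> drv \<Gamma> (All A)"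
proof (induction \<Gamma> arbitrary: A)
  case Nil then show ?case by (simp add: cc_gen)
next
  case (Cons G \<Gamma>)
  then show ?case by simp (meson ax_allI drv_logax drv_mp)
qed

lemma drv_exE:
  "drv \<Gamma> (Ex A) \<Longrightarrow> drv (A # map (lift_fm 0) \<Gamma>) (lift_fm 0 C) \<Longrightarrow> drv \<Gamma> C"
  by (metis ax_exE drv.simps(2) drv_allI drv_logax drv_mp)

lemma drv_subst_Var: "drv \<Gamma> C \<Longrightarrow> drv (map (subst_fm k (Var j)) \<Gamma>) (subst_fm k (Var j) C)"
  by (induction \<Gamma> arbitrary: C) (fastforce simp: cc_prov_subst_Var)+

lemma drv_lift: "drv \<Gamma> C \<Longrightarrow> drv (map (lift_fm k) \<Gamma>) (lift_fm k C)"
  by (induction \<Gamma> arbitrary: C) (fastforce simp: cc_prov_lift)+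

text \<open>The eigenvariable rule for a fresh free index m: shifting everything by one and then
  renaming m, now \<open>Suc m\<close>, to 0 turns the premise into that of
  \<open>drv_allI\<close>.\<close>

lemma drv_allI_fresh:
  assumes "drv \<Gamma> (inst A (Var m))"
    and "\<And>G. G \<in> set \<Gamma> \<Longrightarrow> lift_fm m G = G" and "lift_fm (Suc m) A = A"
  shows "drv \<Gamma> (All A)"
proof -
  let ?f = "\<lambda>B. subst_fm (Suc m) (Var 0) (lift_fm 0 B)"
  have "?f G = lift_fm 0 G" if "G \<in> set \<Gamma>" for G
    using assms(2)[OF that] by (metis lift_lift(2) subst_lift(2) zero_le)
  then have \<Gamma>: "map ?f \<Gamma> = map (lift_fm 0) \<Gamma>" by simp
  have "lift_fm 0 A = lift_fm (Suc (Suc m)) (lift_fm 0 A)"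
    by (simp add: lift_lift assms(3))
  then have *: "subst_fm (Suc (Suc m)) u (lift_fm 0 A) = lift_fm 0 A" for u
    by (metis subst_lift(2))
  have "?f (inst A (Var m)) = A"
    using * by (simp add: inst_def lift_subst_ge subst_subst)
  then have "drv (map (lift_fm 0) \<Gamma>) A"
    using drv_subst_Var[OF drv_lift[OF assms(1), of 0], of "Suc m" 0] \<Gamma>
    by (simp add: comp_def)
  then show ?thesis by (rule drv_allI)
qed

lemma drv_exE_fresh:
  assumes "drv (inst A (Var m) # \<Gamma>) C"
    and "\<And>G. G \<in> set \<Gamma> \<Longrightarrow> lift_fm m G = G" and "lift_fm (Suc m) A = A" and "lift_fm m C = C"
    and "drv \<Gamma> (Ex A)"
  shows "drv \<Gamma> C"
proof -
  have "drv \<Gamma> (inst (Imp A (lift_fm 0 C)) (Var m))" using assms(1) by simp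
  then have "drv \<Gamma> (All (Imp A (lift_fm 0 C)))"
    by (rule drv_allI_fresh) (simp_all add: assms lift_lift)
  then show ?thesis using assms(5) by (meson ax_exE drv_logax drv_mp)
qed

lemma drv_All_mono:
  assumes "drv [A] B" and "drv \<Gamma> (All A)"
  shows "drv \<Gamma> (All B)"
proof -
  \<comment> \<open>The quantifier is opened at its own bound variable: instantiating the shifted
    body at \<open>Var 0\<close> gives back A.\<close>
  have "drv [All (lift_fm (Suc 0) A)] (inst (lift_fm (Suc 0) A) (Var 0))"
    by (rule drv_spec[OF drv_refl])
  then have "drv [All (lift_fm (Suc 0) A)] B"
    using assms(1) by (auto intro: drv_mp drv_prov simp del: drv.simps(2) simp: drv.simps(2)[of A])
  then have "drv [All A] (All B)" by (intro drv_allI) simp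
  then show ?thesis using assms(2) by (auto intro: drv_mp drv_prov)
qed

lemma drv_Ex_mono:
  assumes "drv [A] B" and "drv \<Gamma> (Ex A)"
  shows "drv \<Gamma> (Ex B)"
proof -
  have "drv [A] (inst (lift_fm (Suc 0) B) (Var 0))" using assms(1) by simp
  then have "drv [A] (Ex (lift_fm (Suc 0) B))" by (rule drv_exI)
  then have "drv [A] (lift_fm 0 (Ex B))" by simp
  then have "drv (A # map (lift_fm 0) \<Gamma>) (lift_fm 0 (Ex B))" by (rule drv_mono) simp
  then show ?thesis by (rule drv_exE[OF assms(2)])
qed

section \<open>Rules for the box and for comprehension terms\<close>

lemma drv_Box: "drv \<Gamma> A \<Longrightarrow> drv \<Gamma> (Box A)"
  by (meson cc_box_intro cc_nonlog drv_mp drv_prov)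

lemma drv_Box_mp: "drv \<Gamma> (Box (Imp A B)) \<Longrightarrow> drv \<Gamma> (Box A) \<Longrightarrow> drv \<Gamma> (Box B)"
  by (meson cc_box_imp cc_nonlog drv_mp drv_prov)

lemma drv_Box_mono: "drv [A] B \<Longrightarrow> drv \<Gamma> (Box A) \<Longrightarrow> drv \<Gamma> (Box B)"
  by simp (meson drv_Box drv_Box_mp drv_prov)

lemma drv_Iff_ax:
  assumes "cc_ax (Iff A B)"
  shows "drv \<Gamma> A \<longleftrightarrow> drv \<Gamma> B"
  using assms unfolding Iff_def by (meson cc_nonlog drv_conjD1 drv_conjD2 drv_mp drv_prov)

lemmas drv_Box_Conj = drv_Iff_ax[OF cc_box_conj]
  and drv_Box_Disj = drv_Iff_ax[OF cc_box_disj]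
  and drv_Box_All = drv_Iff_ax[OF cc_box_all]
  and drv_Box_Ex = drv_Iff_ax[OF cc_box_ex]

text \<open>The axiom admits only variables as members. It is taken at a variable fresh for the
  term, hence the shift of A, then generalised and specialised to t.\<close>

lemma drv_Cmp: "drv \<Gamma> (Mem t (Cmp A)) \<longleftrightarrow> drv \<Gamma> (Box (inst A t))"
proof -
  let ?A = "lift_fm (Suc 0) A"
  have "cc_prov (Iff (Mem (Var 0) (Cmp ?A)) (Box A))"
    using cc_term[of 0 ?A] cc_nonlog by simp
  then have "cc_prov (inst (Iff (Mem (Var 0) (Cmp ?A)) (Box A)) t)"
    by (metis cc_gen drv.simps(1) drv_spec)
  then have "cc_prov (Iff (Mem t (Cmp A)) (Box (inst A t)))"
    by (simp add: Iff_def)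
  then show ?thesis
    unfolding Iff_def by (meson drv_conjD1 drv_conjD2 drv_mp drv_prov)
qed

lemma drv_Box_pow: "drv \<Gamma> A \<Longrightarrow> drv \<Gamma> ((Box ^^ n) A)"
  by (induction n) (auto intro: drv_Box)

lemma drv_Box_pow_mp: "drv \<Gamma> ((Box ^^ n) (Imp A B)) \<Longrightarrow> drv \<Gamma> ((Box ^^ n) A) \<Longrightarrow> drv \<Gamma> ((Box ^^ n) B)"
proof (induction n arbitrary: \<Gamma>)
  case (Suc n)
  let ?I = "(Box ^^ n) (Imp A B)" and ?A = "(Box ^^ n) A" and ?B = "(Box ^^ n) B"
  have "drv [?A, ?I] ?B" by (rule Suc.IH) (auto intro: drv_hyp simp del: drv.simps)
  then have "drv \<Gamma> (Box (Imp ?I (Imp ?A ?B)))" by (simp add: drv_Box drv_prov)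
  then show ?case using Suc.prems by simp (blast intro: drv_Box_mp)
qed (auto intro: drv_mp)

section \<open>Polarised boxing\<close>

text \<open>Atoms of polarity True get n boxes, atoms of polarity False none; more boxes thus weaken
  tr True n A and strengthen tr False n A.\<close>

primrec tr :: "bool \<Rightarrow> nat \<Rightarrow> fm \<Rightarrow> fm" where
  "tr p n (Mem s t) = (Box ^^ (if p then n else 0)) (Mem s t)"
| "tr p n (Eq s t) = (Box ^^ (if p then n else 0)) (Eq s t)"
| "tr p n (Conj A B) = Conj (tr p n A) (tr p n B)"
| "tr p n (Disj A B) = Disj (tr p n A) (tr p n B)"
| "tr p n (Imp A B) = Imp (tr (\<not> p) n A) (tr p n B)"
| "tr p n (All A) = All (tr p n A)"
| "tr p n (Ex A) = Ex (tr p n A)"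
| "tr p n (Box A) = tr p n A"

lemma subst_Box_pow: "subst_fm k s ((Box ^^ n) A) = (Box ^^ n) (subst_fm k s A)"
  by (induction n) auto

lemma lift_Box_pow: "lift_fm k ((Box ^^ n) A) = (Box ^^ n) (lift_fm k A)"
  by (induction n) auto

lemma erase_Box_pow: "erase ((Box ^^ n) A) = erase A"
  by (induction n) auto

lemma tr_subst: "subst_fm k s (tr p n A) = tr p n (subst_fm k s A)"
  by (induction A arbitrary: k s p rule: fm_induct) (auto simp: subst_Box_pow)

lemma tr_lift: "lift_fm k (tr p n A) = tr p n (lift_fm k A)"
  by (induction A arbitrary: k p rule: fm_induct) (auto simp: lift_Box_pow)

lemma tr_inst: "tr p n (inst A t) = inst (tr p n A) t"
  by (simp add: inst_def tr_subst)

lemma erase_tr: "erase (tr p n A) = erase A"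
  by (induction A arbitrary: p rule: fm_induct) (auto simp: erase_Box_pow)

text \<open>Both polarities share one statement because the antecedent of an implication flips them.
  The direction flips along, so that at atoms only \<open>A --> Box A\<close> is ever used.\<close>

lemma tr_Suc:
  "drv \<Gamma> (tr p (if p then n else Suc n) A) \<Longrightarrow> drv \<Gamma> (tr p (if p then Suc n else n) A)"
proof (induction A arbitrary: p \<Gamma> rule: fm_induct)
  case (Mem s t) then show ?case by (auto intro: drv_Box)
next
  case (Eq s t) then show ?case by (auto intro: drv_Box)
next
  case (Conj A B)
  from Conj.prems[unfolded tr.simps] show ?case unfolding tr.simps
    by (intro drv_conjI Conj.IH) (rule drv_conjD1 drv_conjD2, assumption)+
next
  case (Disj A B)
  show ?case unfolding tr.simps
    by (rule drv_Disj_mono[OF Disj.IH(1)[OF drv_refl] Disj.IH(2)[OF drv_refl]])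
      (rule Disj.prems[unfolded tr.simps])
next
  case (Imp A B)
  let ?a = "if p then n else Suc n" and ?b = "if p then Suc n else n"
  let ?\<Gamma> = "tr (\<not> p) ?b A # \<Gamma>"
  have "drv ?\<Gamma> (tr (\<not> p) ?b A)" by (rule drv_refl)
  then have "drv ?\<Gamma> (tr (\<not> p) ?a A)" using Imp.IH(1)[of ?\<Gamma> "\<not> p"] by (cases p) auto
  then have "drv ?\<Gamma> (tr p ?a B)"
    using drv_mp drv_weaken[OF Imp.prems[unfolded tr.simps]] by blast
  then have "drv ?\<Gamma> (tr p ?b B)" by (rule Imp.IH(2))
  then show ?case by simp
next
  case (All A)
  from All.prems show ?case unfolding tr.simps by (rule drv_All_mono[OF All.IH[OF drv_refl]])
next
  case (Ex A)
  from Ex.prems show ?case unfolding tr.simps by (rule drv_Ex_mono[OF Ex.IH[OF drv_refl]])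
qed simp

lemma tr_True_mono: "n \<le> m \<Longrightarrow> drv \<Gamma> (tr True n A) \<Longrightarrow> drv \<Gamma> (tr True m A)"
  by (induction m rule: dec_induct) (auto dest: tr_Suc[where p = True, simplified])

lemma tr_False_mono: "n \<le> m \<Longrightarrow> drv \<Gamma> (tr False m A) \<Longrightarrow> drv \<Gamma> (tr False n A)"
  by (induction m rule: dec_induct) (auto dest: tr_Suc[where p = False, simplified])

text \<open>For an implication the antecedent enters the box by A --> Box A, so no converse of the
  K axiom is needed.\<close>

lemma Box_tr: "drv \<Gamma> (Box (tr True n A)) \<Longrightarrow> drv \<Gamma> (tr True (Suc n) A)"
proof (induction A arbitrary: \<Gamma> rule: fm_induct)
  case (Conj A B)
  then show ?case by (simp add: drv_Box_Conj) (meson drv_conjI drv_conjD1 drv_conjD2)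
next
  case (Disj A B)
  have "drv \<Gamma> (Disj (Box (tr True n A)) (Box (tr True n B)))"
    using Disj.prems by (simp add: drv_Box_Disj)
  then show ?case unfolding tr.simps
    by (rule drv_Disj_mono[OF Disj.IH(1)[OF drv_refl] Disj.IH(2)[OF drv_refl]])
next
  case (Imp A B)
  let ?\<Gamma> = "tr False (Suc n) A # \<Gamma>"
  have "drv ?\<Gamma> (tr False (Suc n) A)" by (rule drv_refl)
  then have "drv ?\<Gamma> (Box (tr False n A))" by (intro drv_Box tr_False_mono[of n "Suc n"]) auto
  moreover have "drv ?\<Gamma> (Box (Imp (tr False n A) (tr True n B)))"
    using drv_weaken[OF Imp.prems] by simp
  ultimately have "drv ?\<Gamma> (Box (tr True n B))" by (blast intro: drv_Box_mp)
  then have "drv ?\<Gamma> (tr True (Suc n) B)" by (rule Imp.IH)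
  then show ?case by simp
next
  case (All A)
  have "drv \<Gamma> (All (Box (tr True n A)))" using All.prems by (simp add: drv_Box_All)
  then show ?case unfolding tr.simps by (rule drv_All_mono[OF All.IH[OF drv_refl]])
next
  case (Ex A)
  have "drv \<Gamma> (Ex (Box (tr True n A)))" using Ex.prems by (simp add: drv_Box_Ex)
  then show ?case unfolding tr.simps by (rule drv_Ex_mono[OF Ex.IH[OF drv_refl]])
qed simp_all

lemma Box_pow_tr: "drv \<Gamma> ((Box ^^ k) (tr True n A)) \<Longrightarrow> drv \<Gamma> (tr True (n + k) A)"
proof (induction k arbitrary: \<Gamma>)
  case (Suc k)
  have "drv [(Box ^^ k) (tr True n A)] (tr True (n + k) A)" by (rule Suc.IH[OF drv_refl])
  then have "drv \<Gamma> (Box (tr True (n + k) A))" using Suc.prems by (auto intro: drv_Box_mono)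
  then show ?case using Box_tr by simp
qed simp

text \<open>Unlike positivity, imposes no condition on the terms, hence stable under all
  substitutions.\<close>

primrec pos :: "fm \<Rightarrow> bool" where
  "pos (Mem s t) = True"
| "pos (Eq s t) = True"
| "pos (Conj A B) = (pos A \<and> pos B)"
| "pos (Disj A B) = (pos A \<and> pos B)"
| "pos (Imp A B) = False"
| "pos (All A) = pos A"
| "pos (Ex A) = pos A"
| "pos (Box A) = False"

lemma pos_subst [simp]: "pos (subst_fm k s A) = pos A"
  by (induction A arbitrary: k s rule: fm_induct) auto

lemma pos_inst [simp]: "pos (inst A t) = pos A"
  by (simp add: inst_def)

lemma pos_Bot [simp]: "pos Bot"
  by (simp add: Bot_def)

lemma positive_imp_pos: "positive A \<Longrightarrow> pos A"
  by (induction A rule: fm_induct) auto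

text \<open>Without implications the polarity never flips, so polarity False places no box anywhere.
  For n = 0 it matters that A is free of \<open>Box\<close>, since \<open>tr\<close> deletes the
  boxes already present.\<close>

lemma tr_pos: "pos A \<Longrightarrow> tr False n A = A" "pos A \<Longrightarrow> tr p 0 A = A"
  by (induction A rule: fm_induct) auto

text \<open>A converse of \<open>Box_tr\<close>: boxes on the atoms are gathered in front, as the
  box commutes with every connective and quantifier except implication.\<close>

lemma tr_Suc_pos: "pos A \<Longrightarrow> drv \<Gamma> (tr True (Suc n) A) \<Longrightarrow> drv \<Gamma> (Box (tr True n A))"
proof (induction A arbitrary: \<Gamma> rule: fm_induct)
  case (Conj A B)
  then show ?case by (simp add: drv_Box_Conj) (meson drv_conjI drv_conjD1 drv_conjD2)
next
  case (Disj A B)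
  have "drv \<Gamma> (Disj (Box (tr True n A)) (Box (tr True n B)))"
    using Disj.prems drv_Disj_mono[OF Disj.IH(1)[OF _ drv_refl] Disj.IH(2)[OF _ drv_refl]] by simp
  then show ?case by (simp add: drv_Box_Disj)
next
  case (All A)
  have "drv \<Gamma> (All (Box (tr True n A)))"
    using All.prems drv_All_mono[OF All.IH[OF _ drv_refl]] by simp
  then show ?case by (simp add: drv_Box_All)
next
  case (Ex A)
  have "drv \<Gamma> (Ex (Box (tr True n A)))"
    using Ex.prems drv_Ex_mono[OF Ex.IH[OF _ drv_refl]] by simp
  then show ?case by (simp add: drv_Box_Ex)
qed simp_all

lemma tr_pos_Box_pow: "pos A \<Longrightarrow> drv \<Gamma> (tr True n A) \<Longrightarrow> drv \<Gamma> ((Box ^^ n) A)"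
proof (induction n arbitrary: \<Gamma>)
  case 0 then show ?case by (simp add: tr_pos)
next
  case (Suc n)
  have "drv [tr True n A] ((Box ^^ n) A)" using Suc by (auto intro: drv_refl simp del: drv.simps)
  then show ?case using tr_Suc_pos[OF Suc.prems] by (auto intro: drv_Box_mono)
qed

section \<open>The polarised entailment\<close>

text \<open>Closed under the cut-free rules of the intuitionistic sequent calculus, but under cut
  only for positive cut formulas: a cut formula of higher type would occur with 0 and n boxes
  at the same places.\<close>

definition ent :: "fm list \<Rightarrow> fm \<Rightarrow> bool" where
  "ent \<Gamma> C \<longleftrightarrow> (\<exists>n. drv (map (tr False n) \<Gamma>) (tr True n C))"

lemma entI: "drv (map (tr False n) \<Gamma>) (tr True n C) \<Longrightarrow> ent \<Gamma> C"
  by (auto simp: ent_def)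

text \<open>Raising n strengthens the hypotheses and weakens the conclusion. Two entailments can
  therefore share one n, as the two-premise rules below require.\<close>

lemma drv_tr_mono:
  assumes "n \<le> m" and "drv (map (tr False n) \<Gamma>) (tr True n C)"
  shows "drv (map (tr False m) \<Gamma>) (tr True m C)"
proof -
  have "drv (map (tr False m) \<Gamma>) G" if G: "G \<in> set (map (tr False n) \<Gamma>)" for G
  proof -
    obtain B where B: "B \<in> set \<Gamma>" "G = tr False n B" using G by auto
    then have "drv (map (tr False m) \<Gamma>) (tr False m B)" by (intro drv_hyp) simp
    then show ?thesis using B assms(1) by (auto intro: tr_False_mono)
  qed
  then show ?thesis using drv_trans assms tr_True_mono by blast
qed

lemma entD: "ent \<Gamma> C \<Longrightarrow> \<exists>n. \<forall>m\<ge>n. drv (map (tr False m) \<Gamma>) (tr True m C)"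
  unfolding ent_def using drv_tr_mono by blast

lemma entD2:
  assumes "ent \<Gamma> C" and "ent \<Delta> D"
  obtains n where "drv (map (tr False n) \<Gamma>) (tr True n C)" "drv (map (tr False n) \<Delta>) (tr True n D)"
  using entD[OF assms(1)] entD[OF assms(2)] by (meson nat_le_linear)

lemma ent_mono: "ent \<Gamma> C \<Longrightarrow> set \<Gamma> \<subseteq> set \<Delta> \<Longrightarrow> ent \<Delta> C"
  unfolding ent_def using drv_mono[of "map (tr False n) \<Gamma>" "tr True n C" "map (tr False n) \<Delta>" for n]
  by (metis image_mono list.set_map)

section \<open>Sequent rules for the entailment\<close>

lemma ent_Mem_refl: "ent [Mem s t] (Mem s t)"
  by (rule entI[of 0]) (simp add: drv_refl del: drv.simps)

lemma ent_Eq_refl: "ent [Eq s t] (Eq s t)"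
  by (rule entI[of 0]) (simp add: drv_refl del: drv.simps)

lemma ent_conjL:
  assumes "ent (A # B # \<Gamma>) C"
  shows "ent (Conj A B # \<Gamma>) C"
proof -
  obtain n where n: "drv (map (tr False n) (A # B # \<Gamma>)) (tr True n C)"
    using assms by (auto simp: ent_def)
  let ?\<Gamma> = "map (tr False n) (Conj A B # \<Gamma>)"
  have *: "drv ?\<Gamma> (Conj (tr False n A) (tr False n B))" by (rule drv_hyp) simp
  have "drv ?\<Gamma> (tr True n C)"
    by (rule drv_trans[OF n])
      (use drv_conjD1[OF *] drv_conjD2[OF *] in \<open>auto intro: drv_hyp simp del: drv.simps\<close>)
  then show ?thesis by (rule entI)
qed

lemma ent_conjR:
  assumes "ent \<Gamma> A" and "ent \<Gamma> B"
  shows "ent \<Gamma> (Conj A B)"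
  using entD2[OF assms] by (metis drv_conjI entI tr.simps(3))

lemma ent_disjL:
  assumes "ent (A # \<Gamma>) C" and "ent (B # \<Gamma>) C"
  shows "ent (Disj A B # \<Gamma>) C"
proof -
  obtain n where n: "drv (map (tr False n) (A # \<Gamma>)) (tr True n C)"
    "drv (map (tr False n) (B # \<Gamma>)) (tr True n C)"
    using entD2[OF assms] by blast
  have "drv (map (tr False n) (Disj A B # \<Gamma>)) (tr True n C)"
  proof (rule drv_disjE)
    show "drv (map (tr False n) (Disj A B # \<Gamma>)) (Disj (tr False n A) (tr False n B))"
      by (rule drv_hyp) simp
    show "drv (tr False n A # map (tr False n) (Disj A B # \<Gamma>)) (tr True n C)"
      by (rule drv_mono[OF n(1)]) auto
    show "drv (tr False n B # map (tr False n) (Disj A B # \<Gamma>)) (tr True n C)"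
      by (rule drv_mono[OF n(2)]) auto
  qed
  then show ?thesis by (rule entI)
qed

lemma ent_disjR1: "ent \<Gamma> A \<Longrightarrow> ent \<Gamma> (Disj A B)"
  and ent_disjR2: "ent \<Gamma> B \<Longrightarrow> ent \<Gamma> (Disj A B)"
  by (auto simp: ent_def intro: drv_disjI1 drv_disjI2)

text \<open>The polarity flip fits the rule exactly: in a hypothesis \<open>Imp A B\<close> the
  antecedent is read as \<open>tr True n A\<close>, the form in which the first premise delivers
  A.\<close>

lemma ent_impL:
  assumes "ent \<Gamma> A" and "ent (B # \<Gamma>) C"
  shows "ent (Imp A B # \<Gamma>) C"
proof -
  obtain n where n: "drv (map (tr False n) \<Gamma>) (tr True n A)"
    "drv (map (tr False n) (B # \<Gamma>)) (tr True n C)"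
    using entD2[OF assms] by blast
  let ?\<Gamma> = "map (tr False n) (Imp A B # \<Gamma>)"
  have "drv ?\<Gamma> (Imp (tr True n A) (tr False n B))" by (rule drv_hyp) simp
  moreover have "drv ?\<Gamma> (tr True n A)" by (rule drv_mono[OF n(1)]) auto
  ultimately have *: "drv ?\<Gamma> (tr False n B)" by (rule drv_mp)
  have "drv ?\<Gamma> (tr True n C)"
    by (rule drv_trans[OF n(2)]) (use * in \<open>auto intro: drv_hyp simp del: drv.simps\<close>)
  then show ?thesis by (rule entI)
qed

lemma ent_impR: "ent (A # \<Gamma>) B \<Longrightarrow> ent \<Gamma> (Imp A B)"
  by (auto simp: ent_def)

lemma ent_allL:
  assumes "ent (inst A t # \<Gamma>) C"
  shows "ent (All A # \<Gamma>) C"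
proof -
  obtain n where n: "drv (map (tr False n) (inst A t # \<Gamma>)) (tr True n C)"
    using assms by (auto simp: ent_def)
  let ?\<Gamma> = "map (tr False n) (All A # \<Gamma>)"
  have "drv ?\<Gamma> (All (tr False n A))" by (rule drv_hyp) simp
  then have *: "drv ?\<Gamma> (tr False n (inst A t))" unfolding tr_inst by (rule drv_spec)
  have "drv ?\<Gamma> (tr True n C)"
    by (rule drv_trans[OF n]) (use * in \<open>auto intro: drv_hyp simp del: drv.simps\<close>)
  then show ?thesis by (rule entI)
qed

lemma ent_exR: "ent \<Gamma> (inst A t) \<Longrightarrow> ent \<Gamma> (Ex A)"
  by (auto simp: ent_def tr_inst intro: drv_exI)

text \<open>Each term may come with its own n. The instance at a single fresh variable, with its n,
  gives the universal formula by the eigenvariable rule.\<close>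

lemma ent_allR:
  assumes "\<And>t. ent \<Gamma> (inst A t)"
  shows "ent \<Gamma> (All A)"
proof -
  obtain m where m: "\<And>B k. B \<in> set (A # \<Gamma>) \<Longrightarrow> m \<le> k \<Longrightarrow> lift_fm k B = B"
    using eventually_lift_ident_list[of "A # \<Gamma>"] by blast
  obtain n where "drv (map (tr False n) \<Gamma>) (tr True n (inst A (Var m)))"
    using assms by (auto simp: ent_def)
  then have "drv (map (tr False n) \<Gamma>) (All (tr True n A))"
    unfolding tr_inst by (rule drv_allI_fresh) (auto simp: tr_lift m)
  then show ?thesis by (intro entI[of n]) simp
qed

lemma ent_exL:
  assumes "\<And>t. ent (inst A t # \<Gamma>) C"
  shows "ent (Ex A # \<Gamma>) C"
proof -
  obtain m where m: "\<And>B k. B \<in> set (A # C # \<Gamma>) \<Longrightarrow> m \<le> k \<Longrightarrow> lift_fm k B = B"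
    using eventually_lift_ident_list[of "A # C # \<Gamma>"] by blast
  obtain n where n: "drv (map (tr False n) (inst A (Var m) # \<Gamma>)) (tr True n C)"
    using assms by (auto simp: ent_def)
  have "drv (map (tr False n) (Ex A # \<Gamma>)) (tr True n C)"
  proof (rule drv_exE_fresh)
    show "drv (inst (tr False n A) (Var m) # map (tr False n) (Ex A # \<Gamma>)) (tr True n C)"
      by (rule drv_mono[OF n]) (auto simp: tr_inst)
    show "drv (map (tr False n) (Ex A # \<Gamma>)) (Ex (tr False n A))"
      by (rule drv_hyp) simp
  qed (auto simp: tr_lift m)
  then show ?thesis by (rule entI)
qed

text \<open>A arrives with n boxes on its atoms but is used with none. Gathering the boxes in front
  gives \<open>(Box ^^ n) A\<close>; boxing the second premise n times and applying K puts n boxes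
  before the conclusion, which absorbs them by passing to n + n.\<close>

lemma ent_pos_cut:
  assumes "pos A" and "ent \<Gamma> A" and "ent (A # \<Gamma>) C"
  shows "ent \<Gamma> C"
proof -
  obtain n where n: "drv (map (tr False n) \<Gamma>) (tr True n A)"
    "drv (map (tr False n) (A # \<Gamma>)) (tr True n C)"
    using entD2[OF assms(2,3)] by blast
  let ?\<Gamma> = "map (tr False n) \<Gamma>" and ?\<Delta> = "map (tr False (n + n)) \<Gamma>"
  have "drv ?\<Gamma> ((Box ^^ n) A)" by (rule tr_pos_Box_pow[OF assms(1) n(1)])
  moreover have "drv ?\<Gamma> (Imp A (tr True n C))" using n(2) by (simp add: tr_pos assms(1))
  ultimately have "drv ?\<Gamma> ((Box ^^ n) (tr True n C))"
    by (blast intro: drv_Box_pow drv_Box_pow_mp)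
  then have *: "drv ?\<Gamma> (tr True (n + n) C)" by (rule Box_pow_tr)
  have "drv ?\<Delta> G" if G: "G \<in> set ?\<Gamma>" for G
  proof -
    obtain B where B: "B \<in> set \<Gamma>" "G = tr False n B" using G by auto
    have "drv ?\<Delta> (tr False (n + n) B)" using B(1) by (intro drv_hyp) simp
    then show ?thesis unfolding B(2) by (rule tr_False_mono[rotated]) simp
  qed
  then have "drv ?\<Delta> (tr True (n + n) C)" by (rule drv_trans[OF *])
  then show ?thesis by (rule entI)
qed

lemma ent_Bot: "ent (Bot # \<Gamma>) C"
  by (rule entI[of 0]) (simp add: tr_pos drv_logax ax_efq)

section \<open>Semantic cut elimination\<close>

text \<open>The biorthogonal closure of phase semantics: a pair of \<Delta> and C is a test, passed
  by \<Gamma> if \<open>ent (\<Gamma> @ \<Delta>) C\<close>, and the closure adds whatever passes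
  all tests common to X.\<close>

definition cl :: "fm list set \<Rightarrow> fm list set" where
  "cl X = {\<Gamma>. \<forall>\<Delta> C. (\<forall>\<Theta>\<in>X. ent (\<Theta> @ \<Delta>) C) \<longrightarrow> ent (\<Gamma> @ \<Delta>) C}"

lemma clI: "(\<And>\<Delta> C. (\<And>\<Theta>. \<Theta> \<in> X \<Longrightarrow> ent (\<Theta> @ \<Delta>) C) \<Longrightarrow> ent (\<Gamma> @ \<Delta>) C) \<Longrightarrow> \<Gamma> \<in> cl X"
  by (auto simp: cl_def)

lemma clD: "\<Gamma> \<in> cl X \<Longrightarrow> (\<And>\<Theta>. \<Theta> \<in> X \<Longrightarrow> ent (\<Theta> @ \<Delta>) C) \<Longrightarrow> ent (\<Gamma> @ \<Delta>) C"
  by (auto simp: cl_def)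

lemma subset_cl: "X \<subseteq> cl X"
  by (auto simp: cl_def)

lemma cl_mono: "X \<subseteq> Y \<Longrightarrow> cl X \<subseteq> cl Y"
  unfolding cl_def by blast

lemma cl_cl: "cl (cl X) \<subseteq> cl X"
  by (auto simp: cl_def)

lemma cl_weaken:
  assumes "\<Gamma> \<in> cl X" and "set \<Gamma> \<subseteq> set \<Gamma>'"
  shows "\<Gamma>' \<in> cl X"
proof (rule clI)
  fix \<Delta> C assume "\<And>\<Theta>. \<Theta> \<in> X \<Longrightarrow> ent (\<Theta> @ \<Delta>) C"
  then have "ent (\<Gamma> @ \<Delta>) C" by (rule clD[OF assms(1)])
  then show "ent (\<Gamma>' @ \<Delta>) C" by (rule ent_mono) (use assms(2) in auto)
qed

text \<open>Semantic case analysis, for disjunctions and existential quantifiers: \<Gamma> is kept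
  beside the case \<Theta>, and its repeated copies are contracted, as \<open>ent\<close> depends
  only on the set of hypotheses.\<close>

lemma cl_bind:
  assumes "\<Gamma> \<in> cl X" and "\<And>\<Theta>. \<Theta> \<in> X \<Longrightarrow> \<Gamma> @ \<Theta> \<in> cl Y"
  shows "\<Gamma> \<in> cl Y"
proof (rule clI)
  fix \<Delta> C assume Y: "\<And>\<Theta>. \<Theta> \<in> Y \<Longrightarrow> ent (\<Theta> @ \<Delta>) C"
  have "ent (\<Theta> @ (\<Gamma> @ \<Delta>)) C" if "\<Theta> \<in> X" for \<Theta>
    by (rule ent_mono[OF clD[OF assms(2)[OF that] Y]]) auto
  then have "ent (\<Gamma> @ (\<Gamma> @ \<Delta>)) C" by (rule clD[OF assms(1)])
  then show "ent (\<Gamma> @ \<Delta>) C" by (rule ent_mono) auto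
qed

text \<open>The termination measure of \<open>sem\<close>: an instance \<open>inst A t\<close> may
  be a larger expression than \<open>All A\<close>, but terms sit below the atoms and do not
  count.\<close>

primrec depth :: "fm \<Rightarrow> nat" where
  "depth (Mem s t) = 0"
| "depth (Eq s t) = 0"
| "depth (Conj A B) = Suc (max (depth A) (depth B))"
| "depth (Disj A B) = Suc (max (depth A) (depth B))"
| "depth (Imp A B) = Suc (max (depth A) (depth B))"
| "depth (All A) = Suc (depth A)"
| "depth (Ex A) = Suc (depth A)"
| "depth (Box A) = Suc (depth A)"

lemma depth_subst [simp]: "depth (subst_fm k s A) = depth A"
  by (induction A arbitrary: k s rule: fm_induct) auto

lemma depth_inst [simp]: "depth (inst A t) = depth A"
  by (simp add: inst_def)

text \<open>The syntactic phase model: quantifiers range over all terms, open ones included, and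
  \<open>Box\<close> is invisible, in accordance with \<open>tr\<close>.\<close>

function (sequential) sem :: "fm \<Rightarrow> fm list set" where
  "sem (Mem s t) = {\<Gamma>. ent \<Gamma> (Mem s t)}"
| "sem (Eq s t) = {\<Gamma>. ent \<Gamma> (Eq s t)}"
| "sem (Conj A B) = sem A \<inter> sem B"
| "sem (Disj A B) = cl (sem A \<union> sem B)"
| "sem (Imp A B) = {\<Gamma>. \<forall>\<Delta>\<in>sem A. \<Gamma> @ \<Delta> \<in> sem B}"
| "sem (All A) = (\<Inter>t. sem (inst A t))"
| "sem (Ex A) = cl (\<Union>t. sem (inst A t))"
| "sem (Box A) = sem A"
  by pat_completeness auto
termination by (relation "measure depth") auto

lemma cl_ent: "cl {\<Gamma>. ent \<Gamma> C} = {\<Gamma>. ent \<Gamma> C}"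
proof
  show "cl {\<Gamma>. ent \<Gamma> C} \<subseteq> {\<Gamma>. ent \<Gamma> C}" by (auto dest: clD[where \<Delta> = "[]"])
qed (rule subset_cl)

lemma cl_sem: "cl (sem A) = sem A"
proof (rule antisym[OF _ subset_cl], induction A rule: sem.induct)
  case (3 A B)
  then show ?case using cl_mono[of "sem A \<inter> sem B"] by (metis inf_le1 inf_le2 le_inf_iff order_trans sem.simps(3))
next
  case (5 A B)
  show ?case
  proof
    fix \<Gamma> assume \<Gamma>: "\<Gamma> \<in> cl (sem (Imp A B))"
    \<comment> \<open>Testing \<open>\<Gamma> @ \<Delta>\<close> with \<open>\<Delta>'\<close> and C
      amounts to testing \<Gamma> with \<open>\<Delta> @ \<Delta>'\<close> and C.\<close>
    have "\<Gamma> @ \<Delta> \<in> cl (sem B)" if \<Delta>: "\<Delta> \<in> sem A" for \<Delta>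
    proof (rule clI)
      fix \<Delta>' C assume C: "\<And>\<Theta>. \<Theta> \<in> sem B \<Longrightarrow> ent (\<Theta> @ \<Delta>') C"
      have "ent (\<Theta> @ \<Delta> @ \<Delta>') C" if "\<Theta> \<in> sem (Imp A B)" for \<Theta>
        using C[of "\<Theta> @ \<Delta>"] that \<Delta> by simp
      then show "ent ((\<Gamma> @ \<Delta>) @ \<Delta>') C" using clD[OF \<Gamma>, of "\<Delta> @ \<Delta>'" C] by simp
    qed
    then show "\<Gamma> \<in> sem (Imp A B)" using 5 by auto
  qed
next
  case (6 A)
  have "cl (sem (All A)) \<subseteq> cl (sem (inst A t))" for t by (rule cl_mono) auto
  then show ?case using 6 by fastforce
qed (simp_all add: cl_ent cl_cl)

lemma sem_weaken: "\<Gamma> \<in> sem A \<Longrightarrow> set \<Gamma> \<subseteq> set \<Gamma>' \<Longrightarrow> \<Gamma>' \<in> sem A"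
  using cl_weaken[of \<Gamma> "sem A"] by (simp add: cl_sem)

text \<open>Closedness reduces membership to entailments, where the left rules of \<open>ent\<close>
  can be applied to \<Gamma>.\<close>

lemma sem_leftI:
  assumes "\<And>\<Delta> C. (\<And>\<Theta>. \<Theta> \<in> sem A \<Longrightarrow> ent (\<Theta> @ \<Delta>) C) \<Longrightarrow> ent (\<Gamma> @ \<Delta>) C"
  shows "\<Gamma> \<in> sem A"
  using clI[of "sem A" \<Gamma>] assms by (simp add: cl_sem)

text \<open>Okada's lemma.  In these contexts A is read with polarity False on the left and True on
  the right, and sem connects the two readings without cutting on A.\<close>

lemma sem_ent: "[A] \<in> sem A \<and> (\<forall>\<Gamma>\<in>sem A. ent \<Gamma> A)"
proof (induction A rule: sem.induct)
  case (1 s t) then show ?case by (simp add: ent_Mem_refl)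
next
  case (2 s t) then show ?case by (simp add: ent_Eq_refl)
next
  case (3 A B)
  have "[Conj A B] \<in> sem A"
  proof (rule sem_leftI)
    fix \<Delta> C assume "\<And>\<Theta>. \<Theta> \<in> sem A \<Longrightarrow> ent (\<Theta> @ \<Delta>) C"
    then have "ent ([A] @ \<Delta>) C" using 3 by blast
    then have "ent (A # B # \<Delta>) C" by (rule ent_mono) auto
    then show "ent ([Conj A B] @ \<Delta>) C" by (simp add: ent_conjL)
  qed
  moreover have "[Conj A B] \<in> sem B"
  proof (rule sem_leftI)
    fix \<Delta> C assume "\<And>\<Theta>. \<Theta> \<in> sem B \<Longrightarrow> ent (\<Theta> @ \<Delta>) C"
    then have "ent ([B] @ \<Delta>) C" using 3 by blast
    then have "ent (A # B # \<Delta>) C" by (rule ent_mono) auto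
    then show "ent ([Conj A B] @ \<Delta>) C" by (simp add: ent_conjL)
  qed
  ultimately show ?case using 3 by (auto intro: ent_conjR)
next
  case (4 A B)
  have "[Disj A B] \<in> cl (sem A \<union> sem B)"
  proof (rule clI)
    fix \<Delta> C assume *: "\<And>\<Theta>. \<Theta> \<in> sem A \<union> sem B \<Longrightarrow> ent (\<Theta> @ \<Delta>) C"
    then show "ent ([Disj A B] @ \<Delta>) C"
      using *[of "[A]"] *[of "[B]"] 4 by (auto intro: ent_disjL)
  qed
  moreover have "ent \<Gamma> (Disj A B)" if "\<Gamma> \<in> cl (sem A \<union> sem B)" for \<Gamma>
    using clD[OF that, of "[]"] 4 by (auto intro: ent_disjR1 ent_disjR2)
  ultimately show ?case by simp
next
  case (5 A B)
  have "[Imp A B] @ \<Delta> \<in> sem B" if \<Delta>: "\<Delta> \<in> sem A" for \<Delta>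
  proof (rule sem_leftI)
    fix \<Delta>' C assume "\<And>\<Theta>. \<Theta> \<in> sem B \<Longrightarrow> ent (\<Theta> @ \<Delta>') C"
    then have "ent ([B] @ \<Delta>') C" using 5 by blast
    then have "ent (B # \<Delta> @ \<Delta>') C" by (rule ent_mono) auto
    moreover have "ent (\<Delta> @ \<Delta>') A"
      by (rule ent_mono[of \<Delta>]) (use 5 \<Delta> in auto)
    ultimately show "ent (([Imp A B] @ \<Delta>) @ \<Delta>') C" by (simp add: ent_impL)
  qed
  moreover have "ent \<Gamma> (Imp A B)" if "\<Gamma> \<in> sem (Imp A B)" for \<Gamma>
  proof -
    have "ent (\<Gamma> @ [A]) B" using 5 that by auto
    then have "ent (A # \<Gamma>) B" by (rule ent_mono) auto
    then show ?thesis by (rule ent_impR)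
  qed
  ultimately show ?case by simp
next
  case (6 A)
  have "[All A] \<in> sem (inst A t)" for t
  proof (rule sem_leftI)
    fix \<Delta> C assume "\<And>\<Theta>. \<Theta> \<in> sem (inst A t) \<Longrightarrow> ent (\<Theta> @ \<Delta>) C"
    then have "ent ([inst A t] @ \<Delta>) C" using 6 by blast
    then show "ent ([All A] @ \<Delta>) C" by (auto intro: ent_allL)
  qed
  then show ?case using 6 by (auto intro: ent_allR)
next
  case (7 A)
  have "[Ex A] \<in> cl (\<Union>t. sem (inst A t))"
  proof (rule clI)
    fix \<Delta> C assume "\<And>\<Theta>. \<Theta> \<in> (\<Union>t. sem (inst A t)) \<Longrightarrow> ent (\<Theta> @ \<Delta>) C"
    then have "ent ([inst A t] @ \<Delta>) C" for t using 7 by blast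
    then show "ent ([Ex A] @ \<Delta>) C" by (auto intro: ent_exL)
  qed
  moreover have "ent \<Gamma> (Ex A)" if "\<Gamma> \<in> cl (\<Union>t. sem (inst A t))" for \<Gamma>
  proof -
    have "ent \<Theta> (Ex A)" if "\<Theta> \<in> (\<Union>t. sem (inst A t))" for \<Theta>
      using that 7 ent_exR by blast
    then show ?thesis using clD[OF that, of "[]" "Ex A"] by simp
  qed
  ultimately show ?case by simp
next
  case (8 A)
  have "[Box A] \<in> sem A"
  proof (rule sem_leftI)
    fix \<Delta> C assume "\<And>\<Theta>. \<Theta> \<in> sem A \<Longrightarrow> ent (\<Theta> @ \<Delta>) C"
    then have "ent ([A] @ \<Delta>) C" using 8 by blast
    then show "ent ([Box A] @ \<Delta>) C" by (simp add: ent_def)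
  qed
  then show ?case using 8 by (simp add: ent_def)
qed

lemma sem_imp_ent: "\<Gamma> \<in> sem A \<Longrightarrow> ent \<Gamma> A"
  using sem_ent by blast

text \<open>With \<open>sem_imp_ent\<close>, the model coincides with entailment on
  \<open>pos\<close> formulas: a cut on A replaces \<open>[A]\<close>, which lies in
  \<open>sem A\<close>, by \<Gamma>.\<close>

lemma pos_ent_imp_sem:
  assumes "pos A" and "ent \<Gamma> A"
  shows "\<Gamma> \<in> sem A"
proof (rule sem_leftI)
  fix \<Delta> C assume "\<And>\<Theta>. \<Theta> \<in> sem A \<Longrightarrow> ent (\<Theta> @ \<Delta>) C"
  then have "ent ([A] @ \<Delta>) C" using sem_ent by blast
  then have "ent (A # \<Gamma> @ \<Delta>) C" by (rule ent_mono) auto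
  moreover have "ent (\<Gamma> @ \<Delta>) A" using assms(2) by (rule ent_mono) auto
  ultimately show "ent (\<Gamma> @ \<Delta>) C" using ent_pos_cut assms(1) by blast
qed

text \<open>\<open>Bot\<close> is itself implication-free, so ex falso is a positive cut on
  it.\<close>

lemma sem_Bot:
  assumes "\<Gamma> \<in> sem Bot"
  shows "\<Gamma> \<in> sem A"
proof (rule sem_leftI)
  fix \<Delta> C
  have "ent (\<Gamma> @ \<Delta>) Bot" using sem_imp_ent[OF assms] by (rule ent_mono) auto
  then show "ent (\<Gamma> @ \<Delta>) C" using ent_pos_cut[OF pos_Bot] ent_Bot by blast
qed

text \<open>At n = 0 \<open>tr\<close> leaves the formulas unchanged, so the equality axiom is
  itself an entailment; its two hypotheses are implication-free and can be cut.\<close>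

lemma ent_subst_pos:
  assumes "pos A" and "ent \<Gamma> (Eq s t)" and "ent \<Gamma> (inst A s)"
  shows "ent \<Gamma> (inst A t)"
proof -
  have "drv [inst A s, Eq s t] (inst A t)"
    by (simp add: cc_logax ax_subst)
  then have "ent [inst A s, Eq s t] (inst A t)"
    using assms(1) by (intro entI[of 0]) (simp add: tr_pos del: drv.simps inst_simps)
  then have "ent (inst A s # Eq s t # \<Gamma>) (inst A t)" by (rule ent_mono) auto
  moreover have "ent (Eq s t # \<Gamma>) (inst A s)" using assms(3) by (rule ent_mono) auto
  ultimately have "ent (Eq s t # \<Gamma>) (inst A t)" using ent_pos_cut assms(1) pos_inst by blast
  then show ?thesis using ent_pos_cut[OF _ assms(2)] by simp
qed

lemma ent_sym:
  assumes "ent \<Gamma> (Eq s t)"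
  shows "ent \<Gamma> (Eq t s)"
proof -
  have "ent \<Gamma> (Eq s s)" by (rule entI[of 0]) (simp add: drv_logax ax_refl)
  \<comment> \<open>Leibniz's law for the property of being equal to s, with s shifted past the
    variable.\<close>
  then have "ent \<Gamma> (inst (Eq (Var 0) (lift_tm 0 s)) s)" by simp
  then have "ent \<Gamma> (inst (Eq (Var 0) (lift_tm 0 s)) t)"
    using ent_subst_pos[of "Eq (Var 0) (lift_tm 0 s)", OF _ assms] by simp
  then show ?thesis by simp
qed

text \<open>Lets the quantifier cases below fix the witness r first and then replace s by t in what
  remains.\<close>

lemma inst_inst: "inst (subst_fm (Suc 0) (lift_tm 0 s) A) r = inst (subst_fm 0 (lift_tm 0 r) A) s"
  by (simp add: inst_def subst_subst[where i = 0 and j = 0])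

text \<open>The induction is on \<open>depth\<close>, as the quantifier cases lead to instances that
  are not subformulas; s and t vary because the antecedent of an implication is transported
  backwards, by \<open>ent_sym\<close>.\<close>

lemma sem_subst_Eq:
  "ent \<Gamma> (Eq s t) \<Longrightarrow> \<Gamma> \<in> sem (inst A s) \<Longrightarrow> \<Gamma> \<in> sem (inst A t)"
proof (induction "depth A" arbitrary: A \<Gamma> s t rule: less_induct)
  case less
  have mono: "ent (\<Gamma> @ \<Theta>) (Eq s t)" for \<Theta>
    by (rule ent_mono[OF less.prems(1)]) auto
  have Q: "inst (All B) r = All (subst_fm (Suc 0) (lift_tm 0 r) B)"
    "inst (Ex B) r = Ex (subst_fm (Suc 0) (lift_tm 0 r) B)" for B r
    by (simp_all add: inst_def)
  show ?case
  proof (cases A)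
    case (Mem u v)
    then show ?thesis using less.prems ent_subst_pos[of A \<Gamma> s t] by simp
  next
    case (Eq u v)
    then show ?thesis using less.prems ent_subst_pos[of A \<Gamma> s t] by simp
  next
    case (Conj B C)
    then show ?thesis using less by auto
  next
    case (Disj B C)
    have "\<Gamma> \<in> cl (sem (inst B s) \<union> sem (inst C s))" using less.prems Disj by simp
    then have "\<Gamma> \<in> cl (sem (inst B t) \<union> sem (inst C t))"
    proof (rule cl_bind)
      fix \<Theta> assume "\<Theta> \<in> sem (inst B s) \<union> sem (inst C s)"
      then have "\<Gamma> @ \<Theta> \<in> sem (inst B s) \<or> \<Gamma> @ \<Theta> \<in> sem (inst C s)"
        using sem_weaken[of \<Theta> _ "\<Gamma> @ \<Theta>"] by auto
      then have "\<Gamma> @ \<Theta> \<in> sem (inst B t) \<or> \<Gamma> @ \<Theta> \<in> sem (inst C t)"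
        using less.hyps mono Disj by (metis depth.simps(4) less_Suc_eq_le max.cobounded1 max.cobounded2)
      then show "\<Gamma> @ \<Theta> \<in> cl (sem (inst B t) \<union> sem (inst C t))"
        by (intro subsetD[OF subset_cl]) blast
    qed
    then show ?thesis using Disj by simp
  next
    case (Imp B C)
    have "\<Gamma> @ \<Delta> \<in> sem (inst C t)" if "\<Delta> \<in> sem (inst B t)" for \<Delta>
    proof -
      have "\<Gamma> @ \<Delta> \<in> sem (inst B t)" using that by (rule sem_weaken) auto
      then have "\<Gamma> @ \<Delta> \<in> sem (inst B s)"
        by (rule less.hyps[OF _ ent_sym[OF mono], rotated]) (simp add: Imp)
      then have "\<Gamma> @ \<Gamma> @ \<Delta> \<in> sem (inst C s)" using less.prems(2) Imp by simp
      then have "\<Gamma> @ \<Delta> \<in> sem (inst C s)" by (rule sem_weaken) auto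
      then show ?thesis by (rule less.hyps[OF _ mono, rotated]) (simp add: Imp)
    qed
    then show ?thesis using Imp by simp
  next
    case (All B)
    have "\<Gamma> \<in> sem (inst (subst_fm 0 (lift_tm 0 r) B) s)" for r
      using less.prems(2) All by (simp add: Q inst_inst)
    then have "\<Gamma> \<in> sem (inst (subst_fm 0 (lift_tm 0 r) B) t)" for r
      using less.hyps less.prems(1) All by simp
    then show ?thesis using All by (simp add: Q inst_inst)
  next
    case (Ex B)
    have "\<Gamma> \<in> cl (\<Union>r. sem (inst (subst_fm 0 (lift_tm 0 r) B) s))"
      using less.prems(2) Ex by (simp add: Q inst_inst)
    then have "\<Gamma> \<in> cl (\<Union>r. sem (inst (subst_fm 0 (lift_tm 0 r) B) t))"
    proof (rule cl_bind)
      fix \<Theta> assume "\<Theta> \<in> (\<Union>r. sem (inst (subst_fm 0 (lift_tm 0 r) B) s))"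
      then obtain r where "\<Theta> \<in> sem (inst (subst_fm 0 (lift_tm 0 r) B) s)" by auto
      then have "\<Gamma> @ \<Theta> \<in> sem (inst (subst_fm 0 (lift_tm 0 r) B) s)" by (rule sem_weaken) auto
      then have "\<Gamma> @ \<Theta> \<in> sem (inst (subst_fm 0 (lift_tm 0 r) B) t)"
        by (rule less.hyps[OF _ mono, rotated]) (simp add: Ex)
      then show "\<Gamma> @ \<Theta> \<in> cl (\<Union>r. sem (inst (subst_fm 0 (lift_tm 0 r) B) t))"
        by (intro subsetD[OF subset_cl]) blast
    qed
    then show ?thesis using Ex by (simp add: Q inst_inst)
  next
    case (Box B)
    then show ?thesis using less by simp
  qed
qed

section \<open>Validity of the axioms in the model\<close>

lemma sem_impI:
  assumes "\<And>\<Gamma>. \<Gamma> \<in> sem A \<Longrightarrow> \<Gamma> \<in> sem B"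
  shows "\<Delta> \<in> sem (Imp A B)"
proof -
  have "\<Delta> @ \<Gamma> \<in> sem B" if "\<Gamma> \<in> sem A" for \<Gamma>
    by (rule sem_weaken[OF assms[OF that]]) simp
  then show ?thesis by simp
qed

lemma sem_impD: 
  assumes "\<Gamma> \<in> sem (Imp A B)" and "\<Gamma> \<in> sem A" 
  shows "\<Gamma> \<in> sem B"
proof -
  have "\<Gamma> @ \<Gamma> \<in> sem B" using assms by simp
  then show ?thesis by (rule sem_weaken) simp
qed

lemma sem_logax: "logax A \<Longrightarrow> \<Gamma> \<in> sem A"
proof (induction arbitrary: \<Gamma> rule: logax.induct)
  case (ax_K A B)
  have "\<Gamma> @ \<Delta>1 @ \<Delta>2 \<in> sem A" if "\<Delta>1 \<in> sem A" for \<Delta>1 \<Delta>2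
    by (rule sem_weaken[OF that]) auto
  then show ?case by simp
next
  case (ax_S A B C)
  have "\<Gamma> @ \<Delta>1 @ \<Delta>2 @ \<Delta>3 \<in> sem C"
    if *: "\<Delta>1 \<in> sem (Imp A (Imp B C))" "\<Delta>2 \<in> sem (Imp A B)" "\<Delta>3 \<in> sem A" for \<Delta>1 \<Delta>2 \<Delta>3
  proof -
    let ?\<Gamma> = "\<Gamma> @ \<Delta>1 @ \<Delta>2 @ \<Delta>3"
    have "?\<Gamma> \<in> sem (Imp A (Imp B C))" "?\<Gamma> \<in> sem (Imp A B)" "?\<Gamma> \<in> sem A"
      by (rule sem_weaken[OF *(1)] sem_weaken[OF *(2)] sem_weaken[OF *(3)]; auto)+
    then show ?thesis using sem_impD by blast
  qed
  then show ?case unfolding sem.simps(5)[of "Imp A (Imp B C)"] sem.simps(5)[of "Imp A B"] sem.simps(5)[of A C]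
    by simp
next
  case (ax_conjI A B)
  have "\<Gamma> @ \<Delta>1 @ \<Delta>2 \<in> sem A \<inter> sem B" if "\<Delta>1 \<in> sem A" "\<Delta>2 \<in> sem B" for \<Delta>1 \<Delta>2
    using sem_weaken[OF that(1), of "\<Gamma> @ \<Delta>1 @ \<Delta>2"] sem_weaken[OF that(2), of "\<Gamma> @ \<Delta>1 @ \<Delta>2"]
    by auto
  then show ?case by simp
next
  case (ax_disjI1 A B)
  show ?case using subset_cl[of "sem A \<union> sem B"] by (intro sem_impI) auto
next
  case (ax_disjI2 B A)
  show ?case using subset_cl[of "sem A \<union> sem B"] by (intro sem_impI) auto
next
  case (ax_disjE A C B)
  have "\<Gamma> @ \<Delta>1 @ \<Delta>2 @ \<Delta>3 \<in> sem C"
    if *: "\<Delta>1 \<in> sem (Imp A C)" "\<Delta>2 \<in> sem (Imp B C)" "\<Delta>3 \<in> sem (Disj A B)" for \<Delta>1 \<Delta>2 \<Delta>3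
  proof -
    let ?\<Gamma> = "\<Gamma> @ \<Delta>1 @ \<Delta>2 @ \<Delta>3"
    have 1: "?\<Gamma> \<in> sem (Imp A C)" "?\<Gamma> \<in> sem (Imp B C)" "?\<Gamma> \<in> sem (Disj A B)"
      by (rule sem_weaken[OF *(1)] sem_weaken[OF *(2)] sem_weaken[OF *(3)]; auto)+
    then have "?\<Gamma> \<in> cl (sem A \<union> sem B)" by simp
    then have "?\<Gamma> \<in> cl (sem C)" by (rule cl_bind) (use 1 in \<open>auto simp: cl_sem\<close>)
    then show ?thesis by (simp add: cl_sem)
  qed
  then show ?case by (simp del: sem.simps(4))
next
  case (ax_efq A)
  show ?case by (rule sem_impI) (rule sem_Bot)
next
  case (ax_exI A t)
  show ?case using subset_cl[of "\<Union>t. sem (inst A t)"] by (intro sem_impI) (simp, blast)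
next
  case (ax_allI B A)
  have "\<Gamma> @ \<Delta>1 @ \<Delta>2 \<in> sem (inst A t)"
    if "\<Delta>1 \<in> sem (All (Imp (lift_fm 0 B) A))" "\<Delta>2 \<in> sem B" for \<Delta>1 \<Delta>2 t
  proof -
    have "\<Delta>1 @ \<Delta>2 \<in> sem (inst A t)" using that by simp
    then show ?thesis by (rule sem_weaken) auto
  qed
  then show ?case by simp
next
  case (ax_exE A B)
  have "\<Gamma> @ \<Delta>1 @ \<Delta>2 \<in> sem B"
    if *: "\<Delta>1 \<in> sem (All (Imp A (lift_fm 0 B)))" "\<Delta>2 \<in> sem (Ex A)" for \<Delta>1 \<Delta>2
  proof -
    let ?\<Gamma> = "\<Gamma> @ \<Delta>1 @ \<Delta>2"
    have 1: "?\<Gamma> \<in> sem (All (Imp A (lift_fm 0 B)))" "?\<Gamma> \<in> sem (Ex A)"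
      by (rule sem_weaken[OF *(1)] sem_weaken[OF *(2)]; auto)+
    then have "?\<Gamma> \<in> cl (\<Union>t. sem (inst A t))" by simp
    then have "?\<Gamma> \<in> cl (sem B)" by (rule cl_bind) (use 1(1) in \<open>auto simp: cl_sem\<close>)
    then show ?thesis by (simp add: cl_sem)
  qed
  then show ?case by (simp del: sem.simps(7))
next
  case (ax_refl t)
  show ?case by (simp, rule entI[of 0]) (simp add: drv_logax logax.ax_refl)
next
  case (ax_subst s t A)
  have "\<Gamma> @ \<Delta>1 @ \<Delta>2 \<in> sem (inst A t)"
    if "\<Delta>1 \<in> sem (Eq s t)" "\<Delta>2 \<in> sem (inst A s)" for \<Delta>1 \<Delta>2
  proof (rule sem_subst_Eq)
    show "ent (\<Gamma> @ \<Delta>1 @ \<Delta>2) (Eq s t)" 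
      by (rule ent_mono[of \<Delta>1]) (use that(1) in auto)
    show "\<Gamma> @ \<Delta>1 @ \<Delta>2 \<in> sem (inst A s)" 
      by (rule sem_weaken[of \<Delta>2]) (use that(2) in auto)
  qed
  then show ?case by simp
next
  case (ax_conjE1 A B)
  show ?case by (rule sem_impI) simp
next
  case (ax_conjE2 A B)
  show ?case by (rule sem_impI) simp
next
  case (ax_allE A t)
  show ?case by (rule sem_impI) simp
qed

text \<open>Unfolding yields the box of CC', which \<open>Box_tr\<close> turns into one more box on
  the atoms, hence n = 1; folding uses \<open>A --> Box A\<close> at n = 0. Positive cuts carry both
  over to \<Gamma>.\<close>

lemma ent_Cmp_iff:
  assumes "pos A"
  shows "ent \<Gamma> (Mem t (Cmp A)) \<longleftrightarrow> ent \<Gamma> (inst A t)"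
proof
  have "drv [Mem t (Cmp A)] (Box (inst A t))"
    by (rule iffD1[OF drv_Cmp drv_refl])
  then have "drv [Mem t (Cmp A)] (Box (tr True 0 (inst A t)))"
    using assms by (simp add: tr_pos del: drv.simps)
  then have "drv [Mem t (Cmp A)] (tr True (Suc 0) (inst A t))" by (rule Box_tr)
  then have "ent [Mem t (Cmp A)] (inst A t)" by (intro entI[of "Suc 0"]) simp
  then have "ent (Mem t (Cmp A) # \<Gamma>) (inst A t)" by (rule ent_mono) simp
  then show "ent \<Gamma> (Mem t (Cmp A)) \<Longrightarrow> ent \<Gamma> (inst A t)" using ent_pos_cut pos.simps(1) by blast
next
  have "drv [inst A t] (Mem t (Cmp A))"
    unfolding drv_Cmp by (rule drv_Box[OF drv_refl])
  then have "ent [inst A t] (Mem t (Cmp A))"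
    using assms by (intro entI[of 0]) (simp add: tr_pos)
  then have "ent (inst A t # \<Gamma>) (Mem t (Cmp A))" by (rule ent_mono) simp
  then show "ent \<Gamma> (inst A t) \<Longrightarrow> ent \<Gamma> (Mem t (Cmp A))" using ent_pos_cut assms pos_inst by blast
qed

text \<open>Both sides are implication-free, so the model sees only entailment and assigns them the
  same set of contexts.\<close>

lemma sem_comp:
  assumes "pos A"
  shows "\<Gamma> \<in> sem (Iff (Mem t (Cmp A)) (inst A t))"
proof -
  have "\<Delta> \<in> sem (inst A t) \<longleftrightarrow> ent \<Delta> (inst A t)" for \<Delta>
    by (rule iffI[OF sem_imp_ent pos_ent_imp_sem]) (simp_all add: assms)
  then have "sem (Mem t (Cmp A)) = sem (inst A t)"
    using assms by (auto simp: ent_Cmp_iff)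
  then show ?thesis unfolding Iff_def sem.simps(3)
    by (intro IntI sem_impI) blast+
qed

text \<open>D already follows from comprehension: equating {x : x = x} with {x : Bot} yields Bot.\<close>

lemma sem_D: "\<Gamma> \<in> sem (Ex (Ex (Neg (Eq (Var 1) (Var 0)))))"
proof -
  let ?V = "Cmp (Eq (Var 0) (Var 0))" and ?E = "Cmp Bot"
  have "\<Delta> \<in> sem Bot" if "\<Delta> \<in> sem (Eq ?V ?E)" for \<Delta>
  proof -
    have "ent \<Delta> (inst (Eq (Var 0) (Var 0)) (Var 0))"
      by (rule entI[of 0]) (simp add: drv_logax ax_refl)
    then have "ent \<Delta> (Mem (Var 0) ?V)" by (subst ent_Cmp_iff) simp_all
    \<comment> \<open>\<open>Var 1\<close> becomes \<open>Var 0\<close> once index 0 is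
      instantiated.\<close>
    then have "\<Delta> \<in> sem (inst (Mem (Var 1) (Var 0)) ?V)" by simp
    then have "\<Delta> \<in> sem (inst (Mem (Var 1) (Var 0)) ?E)"
      using sem_subst_Eq that by (metis mem_Collect_eq sem.simps(2))
    then have "ent \<Delta> (Mem (Var 0) ?E)" by simp
    then have "ent \<Delta> (inst Bot (Var 0))" by (subst (asm) ent_Cmp_iff) simp_all
    then show ?thesis by (intro pos_ent_imp_sem) (simp_all add: inst_def)
  qed
  then have "\<Gamma> \<in> sem (Neg (Eq ?V ?E))" unfolding Neg_def by (rule sem_impI)
  then have "\<Gamma> \<in> sem (inst (Neg (Eq ?V (Var 0))) ?E)"
    by (simp add: Neg_def inst_def)
  then have "\<Gamma> \<in> sem (Ex (Neg (Eq ?V (Var 0))))"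
    using subset_cl[of "\<Union>t. sem (inst (Neg (Eq ?V (Var 0))) t)"] by auto
  then have "\<Gamma> \<in> sem (inst (Ex (Neg (Eq (Var 1) (Var 0)))) ?V)"
    by (simp add: Neg_def inst_def)
  then show ?thesis
    using subset_cl[of "\<Union>t. sem (inst (Ex (Neg (Eq (Var 1) (Var 0)))) t)"] by auto
qed

section \<open>Soundness\<close>

abbreviation substs :: "(nat \<times> tm) list \<Rightarrow> fm \<Rightarrow> fm" where
  "substs \<equiv> fold (\<lambda>(k, s). subst_fm k s)"

lemma substs_Imp: "substs \<sigma> (Imp A B) = Imp (substs \<sigma> A) (substs \<sigma> B)"
  by (induction \<sigma> arbitrary: A B) auto

lemma substs_All: "substs \<sigma> (All A) = All (substs (map (\<lambda>(k, s). (Suc k, lift_tm 0 s)) \<sigma>) A)"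
  by (induction \<sigma> arbitrary: A) auto

lemma logax_substs: "logax A \<Longrightarrow> logax (substs \<sigma> A)"
  by (induction \<sigma> arbitrary: A) (auto intro: logax_subst)

text \<open>Substitution turns the member into an arbitrary term and may insert terms from outside
  the positive language, hence t in place of a variable and \<open>pos\<close> in place of
  \<open>positive\<close>.\<close>

lemma substs_comp: "pos A \<Longrightarrow> \<exists>t' A'. pos A' \<and>
    substs \<sigma> (Iff (Mem t (Cmp A)) (inst A t)) = Iff (Mem t' (Cmp A')) (inst A' t')"
proof (induction \<sigma> arbitrary: t A)
  case (Cons x \<sigma>)
  obtain k s where "x = (k, s)" by fastforce
  then show ?case
    using Cons.IH[of "subst_fm (Suc k) (lift_tm 0 s) A" "subst_tm k s t"] Cons.prems
    by (simp add: Iff_def subst_inst)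
qed auto

lemma substs_D: "substs \<sigma> (Ex (Ex (Neg (Eq (Var 1) (Var 0))))) = Ex (Ex (Neg (Eq (Var 1) (Var 0))))"
  by (induction \<sigma>) (auto simp: Neg_def)

text \<open>The substitutions are needed to pass the generalisation rule.\<close>

lemma pf_prov_sound: "pf_prov A \<Longrightarrow> [] \<in> sem (substs \<sigma> A)"
proof (induction arbitrary: \<sigma> rule: pf_prov.induct)
  case (pf_axiom A)
  from pf_axiom(1) show ?case
  proof
    assume "pf_ax A"
    then show ?thesis
    proof cases
      case (pf_comp B n)
      then obtain t' A' where "pos A'" "substs \<sigma> A = Iff (Mem t' (Cmp A')) (inst A' t')"
        using substs_comp positive_imp_pos by blast
      then show ?thesis by (simp only: sem_comp)
    next
      case pf_D
      then show ?thesis using sem_D by (simp only: substs_D)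
    qed
  qed (simp add: logax_substs sem_logax)
next
  case (pf_mp A B)
  then show ?case using sem_impD by (metis substs_Imp)
next
  case (pf_gen A)
  let ?\<sigma> = "map (\<lambda>(k, s). (Suc k, lift_tm 0 s)) \<sigma>"
  \<comment> \<open>Instantiating the bound variable is one more substitution, applied after the
    shifted list, so the induction hypothesis covers every instance.\<close>
  have "[] \<in> sem (inst (substs ?\<sigma> A) t)" for t
    using pf_gen.IH[of "?\<sigma> @ [(0, t)]"] by (simp add: inst_def)
  then show ?case by (simp add: substs_All)
qed

lemma pf_prov_imp_pf_fm: "pf_prov A \<Longrightarrow> pf_fm A"
  by (induction rule: pf_prov.induct) auto

lemma erase_positive: "pf_tm t \<Longrightarrow> erase_tm t = t" "positive A \<Longrightarrow> erase A = A"
  by (induction t and A) auto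

lemma erase_pf_fm: "pf_fm A \<Longrightarrow> erase A = A"
  by (induction A rule: fm_induct) (auto simp: erase_positive)

theorem theorem6p1:
  shows "\<forall>\<phi>. pf_prov \<phi> \<longrightarrow> (\<exists>\<psi>. cc_prov \<psi> \<and> erase \<psi> = \<phi>)"
proof (intro allI impI)
  fix \<phi> assume \<phi>: "pf_prov \<phi>"
  have "[] \<in> sem \<phi>" using pf_prov_sound[OF \<phi>, of "[]"] by simp
  then have "ent [] \<phi>" by (rule sem_imp_ent)
  then obtain n where "cc_prov (tr True n \<phi>)" by (auto simp: ent_def)
  moreover have "erase (tr True n \<phi>) = \<phi>"
    by (simp add: erase_tr erase_pf_fm pf_prov_imp_pf_fm \<phi>)
  ultimately show "\<exists>\<psi>. cc_prov \<psi> \<and> erase \<psi> = \<phi>" by blast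
qed

end
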